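(* Let $C>0$, $\Gamma>0$ and $\beta>0$. There is a constant $\mathcal{C}(\beta,\Gamma,C)>0$ depending only on $(\beta,\Gamma,C)$ such that the following holds. Let $d,n,T\geq 1$ be integers, let $\Theta=\{\theta\in\mathbb{R}^d:\|\theta\|\le C\}$, and suppose every loss $\ell_{t,i}:\Theta\to\mathbb{R}$ ($1\le t\le T$, $1\le i\le n$) is convex and $\Gamma$-Lipschitz. Let $\Lambda=\{\vartheta\in\mathbb{R}^d:\|\vartheta\|\le C\}\times[\underline{\gamma},\bar{\gamma}]$ with $\underline{\gamma}=1/n^\beta$ and $\bar{\gamma}=C^2$ (where $\underline\gamma<\bar\gamma$), and let $$L=\sqrt{\frac{n^2\Gamma^4}{4}+\frac{4C^2}{\underline{\gamma}^2}+\frac{4C^4}{\underline{\gamma}^4}},\qquad \alpha=\frac{C}{L}\sqrt{\frac{4+C^2}{T}}.$$ Suppose the learner uses projected OGA within each task $t$ with parameter $\lambda_t=(\vartheta_t,\gamma_t)$, where $\lambda_1\in\Lambda$ and $\lambda_2,\dots,\lambda_T$ are produced by either OGMS or OPMS with step $\alpha$ and starting point $\lambda_1$. Then $$\sum_{t=1}^T \sum_{i=1}^n \ell_{t,i}(\theta_{t,i}^{\lambda_t})\leq\inf_{\theta_1,\dots,\theta_T \in \Theta} \left\{\sum_{t=1}^T \sum_{i=1}^n \ell_{t,i}(\theta_{t})+ \mathcal{C}(\beta,\Gamma,C) \left[n^{1\vee 2\beta} \sqrt{T} + \left( n^{1-\beta} + \sigma(\theta_1^T) \sqrt{n} \right)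 T\right]\right\},$$ where $$\sigma(\theta_1^T) = \sqrt{\frac{1}{T}\sum_{t=1}^T \left\| \theta_t - \frac{1}{T}\sum_{s=1}^T \theta_s \right\|^2 }.$$
   Context: $\|\cdot\|$ is the Euclidean norm, $a\vee b=\max(a,b)$, and $\Pi_K$ denotes orthogonal projection on a closed convex set $K$. Tasks $t=1,\dots,T$ are processed sequentially, each with $n$ rounds; at round $i$ of task $t$ the learner plays $\theta_{t,i}\in\Theta$ and then $\ell_{t,i}$ is revealed. Within-task strategy (projected online gradient algorithm, OGA) with parameter $\lambda=(\vartheta,\gamma)$ (initialization and step size): $\theta_{t,1}^\lambda=\vartheta$ and, for $1<i\le n$, $\theta_{t,i}^\lambda=\Pi_\Theta[\theta_{t,i-1}^\lambda-\gamma\nabla\ell_{t,i-1}(\theta_{t,i-1}^\lambda)]$, where $\nabla\ell_{t,i}(\theta)$ denotes a subgradient of $\ell_{t,i}$ at $\theta$ of norm at most $\Gamma$. Meta-loss: for $(\vartheta,\gamma)\in\Lambda$, $$\mathcal{L}_t((\vartheta,\gamma))=\inf_{\|\theta\|\le C}\Big\{\sum_{i=1}^n\ell_{t,i}(\theta)+\frac{\gamma\Gamma^2n}{2}+\frac{\|\theta-\vartheta\|^2}{2\gamma}\Big\}.$$ OGMS with step $\alpha$ and starting point $\lambda_1$: for $t>1$, $\lambda_t=\Pi_\Lambda[\lambda_{t-1}-\alpha\nabla\mathcal{L}_{t-1}(\lambda_{t-1})]$, where $\nabla\mathcal{L}_t(\lambda)$ denotes any element, of norm at most $L$, of the subdifferential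 of the convex function $\mathcal{L}_t:\Lambda\to\mathbb{R}$ at $\lambda$. OPMS with step $\alpha$ and starting point $\lambda_1$: for $t>1$, $\lambda_t=\operatorname{argmin}_{\lambda\in\Lambda}\big\{\mathcal{L}_{t-1}(\lambda)+\frac{\|\lambda-\lambda_{t-1}\|^2}{2\alpha}\big\}$ (Euclidean norm on $\mathbb{R}^{d+1}$). *)

theory Defs
  imports "HOL-Analysis.Analysis"
begin

text \<open>
  The constant in the theorem must not depend on the dimension \<open>d\<close>, so \<open>d\<close> has to be quantified
  inside the formula and cannot be a type. All spaces \<open>\<real>\<^sup>d\<close> are therefore taken inside the single
  inner product space \<open>fsvec\<close> of finitely supported real sequences: \<open>Rd d\<close> consists of the
  sequences supported on \<open>{..<d}\<close>, and on it the norm is the usual Euclidean norm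
  (lemmas \<open>inner_Rd\<close>, \<open>norm_Rd\<close>, \<open>Rd_vector\<close>).
\<close>

typedef fsvec = "{f :: nat \<Rightarrow> real. finite {i. f i \<noteq> 0}}"
  morphisms coord Abs_fsvec
  by (intro exI[of _ "\<lambda>_. 0"]) simp

lemma finite_supp [simp]: "finite {i. coord x i \<noteq> 0}"
  using coord[of x] by simp

lemma fsvec_eqI: "(\<And>i. coord x i = coord y i) \<Longrightarrow> x = y"
  by (metis coord_inject ext)

lemma coord_Abs_fsvec: "finite {i. f i \<noteq> 0} \<Longrightarrow> coord (Abs_fsvec f) = f"
  by (simp add: Abs_fsvec_inverse)

instantiation fsvec :: real_vector
begin

definition zero_fsvec :: fsvec where
  "0 = Abs_fsvec (\<lambda>_. 0)"
definition plus_fsvec :: "fsvec \<Rightarrow> fsvec \<Rightarrow> fsvec" where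
  "x + y = Abs_fsvec (\<lambda>i. coord x i + coord y i)"
definition minus_fsvec :: "fsvec \<Rightarrow> fsvec \<Rightarrow> fsvec" where
  "x - y = Abs_fsvec (\<lambda>i. coord x i - coord y i)"
definition uminus_fsvec :: "fsvec \<Rightarrow> fsvec" where
  "- x = Abs_fsvec (\<lambda>i. - coord x i)"
definition scaleR_fsvec :: "real \<Rightarrow> fsvec \<Rightarrow> fsvec" where
  "a *\<^sub>R x = Abs_fsvec (\<lambda>i. a * coord x i)"

lemma coord_zero [simp]: "coord 0 i = 0"
  by (simp add: zero_fsvec_def coord_Abs_fsvec)

lemma coord_add [simp]: "coord (x + y) i = coord x i + coord y i"
proof -
  have "finite {i. coord x i + coord y i \<noteq> 0}"
    by (rule finite_subset[of _ "{i. coord x i \<noteq> 0} \<union> {i. coord y i \<noteq> 0}"]) auto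
  then show ?thesis by (simp only: plus_fsvec_def coord_Abs_fsvec)
qed

lemma coord_diff [simp]: "coord (x - y) i = coord x i - coord y i"
proof -
  have "finite {i. coord x i - coord y i \<noteq> 0}"
    by (rule finite_subset[of _ "{i. coord x i \<noteq> 0} \<union> {i. coord y i \<noteq> 0}"]) auto
  then show ?thesis by (simp only: minus_fsvec_def coord_Abs_fsvec)
qed

lemma coord_uminus [simp]: "coord (- x) i = - coord x i"
  by (simp add: uminus_fsvec_def coord_Abs_fsvec)

lemma coord_scaleR [simp]: "coord (a *\<^sub>R x) i = a * coord x i"
proof -
  have "finite {i. a * coord x i \<noteq> 0}"
    by (rule finite_subset[of _ "{i. coord x i \<noteq> 0}"]) auto
  then show ?thesis by (simp only: scaleR_fsvec_def coord_Abs_fsvec)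
qed

instance
proof
  fix x y z :: fsvec and a b :: real
  show "x + y + z = x + (y + z)" "x + y = y + x" "0 + x = x" "- x + x = 0" "x - y = x + - y"
    "a *\<^sub>R (x + y) = a *\<^sub>R x + a *\<^sub>R y" "(a + b) *\<^sub>R x = a *\<^sub>R x + b *\<^sub>R x"
    "a *\<^sub>R b *\<^sub>R x = (a * b) *\<^sub>R x" "1 *\<^sub>R x = x"
    by (rule fsvec_eqI; simp add: algebra_simps)+
qed

end

instantiation fsvec :: real_normed_vector
begin

definition norm_fsvec :: "fsvec \<Rightarrow> real" where
  "norm x = L2_set (coord x) {i. coord x i \<noteq> 0}"
definition sgn_fsvec :: "fsvec \<Rightarrow> fsvec" where
  "sgn_fsvec x = x /\<^sub>R norm x"
definition dist_fsvec :: "fsvec \<Rightarrow> fsvec \<Rightarrow> real" where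
  "dist_fsvec x y = norm (x - y)"
definition uniformity_fsvec :: "(fsvec \<times> fsvec) filter" where
  "uniformity = (INF e\<in>{0<..}. principal {(x, y). dist (x::fsvec) y < e})"
definition open_fsvec :: "fsvec set \<Rightarrow> bool" where
  "open_fsvec U \<longleftrightarrow> (\<forall>x\<in>U. \<forall>\<^sub>F (x', y) in uniformity. x' = x \<longrightarrow> y \<in> U)"

lemma norm_fsvec_supp:
  assumes "finite A" "{i. coord x i \<noteq> 0} \<subseteq> A"
  shows "norm x = L2_set (coord x) A"
  unfolding norm_fsvec_def L2_set_def using assms
  by (intro arg_cong[where f = sqrt] sum.mono_neutral_left) auto

instance
proof
  fix x y :: fsvec and a :: real and U :: "fsvec set"
  let ?S = "\<lambda>x. {i. coord x i \<noteq> 0}"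
  show "dist x y = norm (x - y)" by (rule dist_fsvec_def)
  show "sgn x = x /\<^sub>R norm x" by (rule sgn_fsvec_def)
  show "uniformity = (INF e\<in>{0<..}. principal {(x, y). dist (x::fsvec) y < e})"
    by (rule uniformity_fsvec_def)
  show "open U \<longleftrightarrow> (\<forall>x\<in>U. \<forall>\<^sub>F (x', y) in uniformity. x' = x \<longrightarrow> y \<in> U)"
    by (rule open_fsvec_def)
  show "norm x = 0 \<longleftrightarrow> x = 0"
    by (auto simp: norm_fsvec_def L2_set_eq_0_iff intro: fsvec_eqI)
  have *: "norm x = L2_set (coord x) (?S x \<union> ?S y)" "norm y = L2_set (coord y) (?S x \<union> ?S y)"
    "norm (x + y) = L2_set (coord (x + y)) (?S x \<union> ?S y)"
    by (rule norm_fsvec_supp; auto)+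
  have "coord (x + y) = (\<lambda>i. coord x i + coord y i)" by auto
  then show "norm (x + y) \<le> norm x + norm y"
    using L2_set_triangle_ineq[of "coord x" "coord y" "?S x \<union> ?S y"] by (simp add: *)
  have "norm (a *\<^sub>R x) = L2_set (coord (a *\<^sub>R x)) (?S x)"
    by (rule norm_fsvec_supp) auto
  then show "norm (a *\<^sub>R x) = \<bar>a\<bar> * norm x"
    by (simp add: norm_fsvec_def L2_set_def power_mult_distrib sum_distrib_left[symmetric]
        real_sqrt_mult)
qed

end

instantiation fsvec :: real_inner
begin

definition inner_fsvec :: "fsvec \<Rightarrow> fsvec \<Rightarrow> real" where
  "inner x y = (\<Sum>i | coord x i \<noteq> 0. coord x i * coord y i)"

lemma inner_fsvec_supp:
  assumes "finite A" "{i. coord x i \<noteq> 0} \<subseteq> A"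
  shows "inner x y = (\<Sum>i\<in>A. coord x i * coord y i)"
  unfolding inner_fsvec_def using assms by (intro sum.mono_neutral_left) auto

instance
proof
  fix x y z :: fsvec and a :: real
  let ?S = "\<lambda>x. {i. coord x i \<noteq> 0}"
  show "norm x = sqrt (inner x x)"
    by (simp add: norm_fsvec_def L2_set_def inner_fsvec_def power2_eq_square)
  have "inner x y = (\<Sum>i\<in>?S x \<union> ?S y. coord x i * coord y i)"
    by (rule inner_fsvec_supp) auto
  moreover have "inner y x = (\<Sum>i\<in>?S x \<union> ?S y. coord y i * coord x i)"
    by (rule inner_fsvec_supp) auto
  ultimately show "inner x y = inner y x" by (simp add: mult.commute)
  have "inner (x + y) z = (\<Sum>i\<in>?S x \<union> ?S y. coord (x + y) i * coord z i)"
    by (rule inner_fsvec_supp) auto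
  moreover have "inner x z = (\<Sum>i\<in>?S x \<union> ?S y. coord x i * coord z i)"
    by (rule inner_fsvec_supp) auto
  moreover have "inner y z = (\<Sum>i\<in>?S x \<union> ?S y. coord y i * coord z i)"
    by (rule inner_fsvec_supp) auto
  ultimately show "inner (x + y) z = inner x z + inner y z"
    by (simp add: sum.distrib algebra_simps)
  have "inner (a *\<^sub>R x) y = (\<Sum>i\<in>?S x. coord (a *\<^sub>R x) i * coord y i)"
    by (rule inner_fsvec_supp) auto
  then show "inner (a *\<^sub>R x) y = a * inner x y"
    by (simp add: inner_fsvec_def sum_distrib_left mult.assoc)
  show "0 \<le> inner x x"
    unfolding inner_fsvec_def by (intro sum_nonneg) simp
  show "inner x x = 0 \<longleftrightarrow> x = 0"
  proof
    assume "inner x x = 0"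
    then have "\<forall>i\<in>?S x. coord x i * coord x i = 0"
      unfolding inner_fsvec_def by (subst (asm) sum_nonneg_eq_0_iff) auto
    then show "x = 0" by (intro fsvec_eqI) auto
  qed (simp add: inner_fsvec_def)
qed

end

definition Rd :: "nat \<Rightarrow> fsvec set" where
  "Rd d = {x. \<forall>i\<ge>d. coord x i = 0}"

lemma Rd_vector: "bij_betw coord (Rd d) {f. \<forall>i\<ge>d. f i = 0}"
proof (rule bij_betw_byWitness[where f' = Abs_fsvec])
  have fin: "finite {i. f i \<noteq> 0}" if "\<forall>i\<ge>d. f i = 0" for f :: "nat \<Rightarrow> real"
    by (rule finite_subset[of _ "{..<d}"]) (use that not_le in auto)
  show "\<forall>f\<in>{f. \<forall>i\<ge>d. f i = 0}. coord (Abs_fsvec f) = f"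
    "Abs_fsvec ` {f. \<forall>i\<ge>d. f i = 0} \<subseteq> Rd d"
    using fin by (auto simp: coord_Abs_fsvec Rd_def)
qed (auto simp: Rd_def coord_inverse)

lemma inner_Rd: "x \<in> Rd d \<Longrightarrow> inner x y = (\<Sum>i<d. coord x i * coord y i)"
  by (rule inner_fsvec_supp) (auto simp: Rd_def not_le[symmetric])

lemma norm_Rd: "x \<in> Rd d \<Longrightarrow> norm x = L2_set (coord x) {..<d}"
  by (rule norm_fsvec_supp) (auto simp: Rd_def not_le[symmetric])

text \<open>Subgradients at \<open>x \<in> S\<close> of a function on \<open>S \<subseteq> V\<close>, where \<open>V\<close> is the ambient Euclidean space.\<close>

definition subdifferential ::
  "'a::real_inner set \<Rightarrow> 'a set \<Rightarrow> ('a \<Rightarrow> real) \<Rightarrow> 'a \<Rightarrow> 'a set" where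
  "subdifferential V S f x = {g \<in> V. \<forall>y\<in>S. f x + inner g (y - x) \<le> f y}"

text \<open>\<open>p = \<Pi>\<^sub>K x\<close>; stated as a relation because \<^const>\<open>closest_point\<close> requires a Heine-Borel type.\<close>

definition is_projection :: "'a::metric_space set \<Rightarrow> 'a \<Rightarrow> 'a \<Rightarrow> bool" where
  "is_projection K x p \<longleftrightarrow> is_arg_min (\<lambda>y. dist x y) (\<lambda>y. y \<in> K) p"

definition Theta_set :: "nat \<Rightarrow> real \<Rightarrow> fsvec set" where
  "Theta_set d C = {\<theta> \<in> Rd d. norm \<theta> \<le> C}"

definition gamma_min :: "nat \<Rightarrow> real \<Rightarrow> real" where
  "gamma_min n \<beta> = 1 / real n powr \<beta>"

definition gamma_max :: "real \<Rightarrow> real" where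
  "gamma_max C = C\<^sup>2"

text \<open>The product type carries the Euclidean norm of \<open>\<real>\<^sup>d\<^sup>+\<^sup>1\<close>.\<close>

definition Lambda_set :: "nat \<Rightarrow> real \<Rightarrow> nat \<Rightarrow> real \<Rightarrow> (fsvec \<times> real) set" where
  "Lambda_set d C n \<beta> = Theta_set d C \<times> {gamma_min n \<beta>..gamma_max C}"

definition oga_run ::
  "nat \<Rightarrow> real \<Rightarrow> real \<Rightarrow> nat \<Rightarrow> (nat \<Rightarrow> fsvec \<Rightarrow> real) \<Rightarrow> fsvec \<times> real \<Rightarrow> (nat \<Rightarrow> fsvec) \<Rightarrow> bool" where
  "oga_run d C \<Gamma> n l lam \<theta> \<longleftrightarrow>
     \<theta> 1 = fst lam \<and>
     (\<forall>i\<in>{2..n}. \<exists>g \<in> subdifferential (Rd d) (Theta_set d C) (l (i - 1)) (\<theta> (i - 1)).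
        norm g \<le> \<Gamma> \<and>
        is_projection (Theta_set d C) (\<theta> (i - 1) - snd lam *\<^sub>R g) (\<theta> i))"

definition meta_loss ::
  "nat \<Rightarrow> real \<Rightarrow> real \<Rightarrow> nat \<Rightarrow> (nat \<Rightarrow> fsvec \<Rightarrow> real) \<Rightarrow> fsvec \<times> real \<Rightarrow> real" where
  "meta_loss d C \<Gamma> n l = (\<lambda>(v, \<gamma>).
     INF \<theta>\<in>Theta_set d C.
       (\<Sum>i=1..n. l i \<theta>) + \<gamma> * \<Gamma>\<^sup>2 * real n / 2 + (norm (\<theta> - v))\<^sup>2 / (2 * \<gamma>))"

text \<open>In both meta-strategies \<open>f t\<close> is the meta-loss of task \<open>t\<close> and \<open>S\<close> the parameter set.\<close>

definition ogms_run ::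
  "'a::real_inner set \<Rightarrow> 'a set \<Rightarrow> (nat \<Rightarrow> 'a \<Rightarrow> real) \<Rightarrow> real \<Rightarrow> real \<Rightarrow> nat \<Rightarrow> (nat \<Rightarrow> 'a) \<Rightarrow> bool" where
  "ogms_run V S f L \<alpha> T lam \<longleftrightarrow>
     lam 1 \<in> S \<and>
     (\<forall>t\<in>{2..T}. \<exists>g \<in> subdifferential V S (f (t - 1)) (lam (t - 1)).
        norm g \<le> L \<and> is_projection S (lam (t - 1) - \<alpha> *\<^sub>R g) (lam t))"

definition opms_run ::
  "'a::real_inner set \<Rightarrow> (nat \<Rightarrow> 'a \<Rightarrow> real) \<Rightarrow> real \<Rightarrow> nat \<Rightarrow> (nat \<Rightarrow> 'a) \<Rightarrow> bool" where
  "opms_run S f \<alpha> T lam \<longleftrightarrow>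
     lam 1 \<in> S \<and>
     (\<forall>t\<in>{2..T}. is_arg_min
        (\<lambda>x. f (t - 1) x + (norm (x - lam (t - 1)))\<^sup>2 / (2 * \<alpha>)) (\<lambda>x. x \<in> S) (lam t))"

definition meta_L :: "real \<Rightarrow> real \<Rightarrow> real \<Rightarrow> nat \<Rightarrow> real" where
  "meta_L C \<Gamma> \<beta> n =
     sqrt ((real n)\<^sup>2 * \<Gamma> ^ 4 / 4 + 4 * C\<^sup>2 / (gamma_min n \<beta>)\<^sup>2 + 4 * C ^ 4 / gamma_min n \<beta> ^ 4)"

definition meta_alpha :: "real \<Rightarrow> real \<Rightarrow> real \<Rightarrow> nat \<Rightarrow> nat \<Rightarrow> real" where
  "meta_alpha C \<Gamma> \<beta> n T = C / meta_L C \<Gamma> \<beta> n * sqrt ((4 + C\<^sup>2) / real T)"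

definition sigma :: "nat \<Rightarrow> (nat \<Rightarrow> 'a::real_normed_vector) \<Rightarrow> real" where
  "sigma T \<theta> =
     sqrt (1 / real T * (\<Sum>t=1..T. (norm (\<theta> t - (1 / real T) *\<^sub>R (\<Sum>s=1..T. \<theta> s)))\<^sup>2))"

end

(* Projected subgradient steps and proximal steps satisfy the same one-step inequality, which
   telescopes. Within a task it shows that the loss of OGA is at most the meta-loss of its parameter.
   The meta-loss is a partial infimum of a jointly convex function (a quadratic over a linear term)
   and L-Lipschitz on the parameter set, so across tasks the same inequality applies with step alpha
   balanced against the diameter of the parameter set. The total meta-loss of a fixed parameter is
   then estimated with the mean of the comparators as initialization and a step size of order
   sigma / sqrt n. *)

theory Submission
  imports Defs
begin

section \<open>Online regret of proximal and projected steps\<close>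

text \<open>The meta-loss is the OGA regret bound with the comparator minimized out, so the
  meta-strategies work on a certified upper bound of the loss suffered. The obstacle is its
  quadratic term divided by \<open>2 * \<gamma>\<close>, which is not Lipschitz as \<gamma> tends to
  0. The lower end \<open>gamma_min\<close> of the step sizes cures this at two prices. The slope in
  \<gamma> can still reach order \<open>1 / gamma_min^2\<close>, that is n^(2 \<beta>); together
  with the slope of order n of the linear term this makes L at most of order n^max(1, 2 \<beta>).
  And no comparison step size may fall below \<open>gamma_min\<close>, which costs order
  \<open>n * gamma_min\<close>, that is n^(1 - \<beta>), per task. Projections and minimizers enter
  only through their minimality, and infima only through bounds valid for every \<theta>, which
  keeps all estimates free of the dimension.\<close>

lemma norm_sq_convex_combination:
  fixes p y a :: "'a::real_inner"
  shows "(norm ((1 - s) *\<^sub>R p + s *\<^sub>R y - a))\<^sup>2 =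
    (1 - s) * (norm (p - a))\<^sup>2 + s * (norm (y - a))\<^sup>2 - s * (1 - s) * (norm (y - p))\<^sup>2"
proof -
  define u w where "u = p - a" and "w = y - a"
  have "(1 - s) *\<^sub>R p + s *\<^sub>R y - a = (1 - s) *\<^sub>R u + s *\<^sub>R w" "y - p = w - u"
    by (simp_all add: u_def w_def algebra_simps)
  moreover have "(norm ((1 - s) *\<^sub>R u + s *\<^sub>R w))\<^sup>2 =
    (1 - s) * (norm u)\<^sup>2 + s * (norm w)\<^sup>2 - s * (1 - s) * (norm (w - u))\<^sup>2"
    unfolding power2_norm_eq_inner
    by (simp add: inner_simps inner_commute[of w u] algebra_simps power2_eq_square)
  ultimately show ?thesis
    by (simp add: u_def w_def)
qed

text \<open>The gain in \<open>norm (p - y)\<close> over plain minimality comes from the strong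
  convexity of the square, which \<open>norm_sq_convex_combination\<close> expresses as an exact
  identity. Minimality is tested at points of the segment from \<open>p\<close> to \<open>y\<close>
  that tend to \<open>p\<close>.\<close>

lemma proximal_three_point:
  fixes p y a :: "'a::real_inner"
  assumes conv: "convex_on S f" and "\<alpha> > 0" and p: "p \<in> S" and y: "y \<in> S"
    and min: "\<And>z. z \<in> S \<Longrightarrow>
      f p + (norm (p - a))\<^sup>2 / (2 * \<alpha>) \<le> f z + (norm (z - a))\<^sup>2 / (2 * \<alpha>)"
  shows "f p + (norm (p - a))\<^sup>2 / (2 * \<alpha>) + (norm (p - y))\<^sup>2 / (2 * \<alpha>) \<le>
    f y + (norm (y - a))\<^sup>2 / (2 * \<alpha>)"
proof -
  define p' y' where "p' = (norm (p - a))\<^sup>2 / (2 * \<alpha>)" and "y' = (norm (y - a))\<^sup>2 / (2 * \<alpha>)"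
  define P Y B where "P = f p + p'" and "Y = f y + y'" and "B = (norm (p - y))\<^sup>2 / (2 * \<alpha>)"
  \<comment> \<open>Here \<open>s = 1 - r\<close> is the weight of \<open>y\<close>. Minimality
    against \<open>z\<close>, divided by \<open>s\<close>, leaves the factor
    \<open>1 - s = r\<close> on \<open>B\<close>; letting \<open>r\<close> tend to 1 removes
    it.\<close>
  have "r * B \<le> Y - P" if r: "0 < r" "r < 1" for r
  proof -
    define s z where "s = 1 - r" and "z = (1 - s) *\<^sub>R p + s *\<^sub>R y"
    have s: "0 < s" "s < 1" using r by (auto simp: s_def)
    have "z \<in> S"
      using conv p y s unfolding convex_on_def convex_alt z_def by auto
    then have "P \<le> f z + (norm (z - a))\<^sup>2 / (2 * \<alpha>)"
      using min by (simp add: P_def p'_def)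
    also have "f z \<le> (1 - s) * f p + s * f y"
      using convex_onD[OF conv _ _ p y, of s] s by (simp add: z_def)
    also have "(norm (z - a))\<^sup>2 / (2 * \<alpha>) =
        (1 - s) * p' + s * y' - s * (1 - s) * B"
      unfolding z_def norm_sq_convex_combination B_def p'_def y'_def
      by (simp add: norm_minus_commute add_divide_distrib diff_divide_distrib)
    finally have "s * (P + (1 - s) * B) \<le> s * Y"
      by (simp add: P_def Y_def algebra_simps)
    then show ?thesis
      using s by (simp add: s_def)
  qed
  then have "B \<le> Y - P"
    by (rule field_le_mult_one_interval)
  then show ?thesis
    by (simp add: P_def Y_def B_def p'_def y'_def)
qed

lemma is_projection_in: "is_projection K x p \<Longrightarrow> p \<in> K"
  by (simp add: is_projection_def is_arg_min_def)

text \<open>A projection is a proximal step for the zero function; the choice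
  \<open>\<alpha> = 1/2\<close> turns \<open>1 / (2 * \<alpha>)\<close> into 1, and the three-point
  inequality becomes the obtuse-angle inequality.\<close>

lemma is_projection_norm_le:
  fixes x y :: "'a::real_inner"
  assumes "convex K" and proj: "is_projection K x p" and "y \<in> K"
  shows "(norm (p - y))\<^sup>2 \<le> (norm (x - y))\<^sup>2"
proof -
  have "(norm (p - x))\<^sup>2 \<le> (norm (z - x))\<^sup>2" if "z \<in> K" for z
    using proj that
    by (intro power_mono) (auto simp: is_projection_def is_arg_min_linorder dist_norm norm_minus_commute)
  then have "(norm (p - x))\<^sup>2 + (norm (p - y))\<^sup>2 \<le> (norm (y - x))\<^sup>2"
    using proximal_three_point[of K "\<lambda>_. 0" "1/2" p y x] assms is_projection_in[OF proj]
    by (simp add: convex_on_const)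
  then show ?thesis
    using zero_le_power2[of "norm (p - x)"] unfolding norm_minus_commute[of x y] by linarith
qed

lemma young_ineq:
  fixes \<alpha> M r :: real
  assumes "\<alpha> > 0"
  shows "M * r \<le> r\<^sup>2 / (2 * \<alpha>) + \<alpha> * M\<^sup>2 / 2"
proof -
  have "0 \<le> (r - \<alpha> * M)\<^sup>2 / (2 * \<alpha>)"
    using assms by simp
  also have "\<dots> = r\<^sup>2 / (2 * \<alpha>) + \<alpha> * M\<^sup>2 / 2 - M * r"
    using assms by (simp add: field_simps power2_eq_square)
  finally show ?thesis by simp
qed

lemma projected_subgradient_step:
  fixes x g y :: "'a::real_inner"
  assumes "convex S" and "x \<in> S" and "y \<in> S" and "\<alpha> > 0"
    and g: "g \<in> subdifferential V S f x" "norm g \<le> M"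
    and proj: "is_projection S (x - \<alpha> *\<^sub>R g) x'"
  shows "f x - f y \<le> ((norm (x - y))\<^sup>2 - (norm (x' - y))\<^sup>2) / (2 * \<alpha>) + \<alpha> * M\<^sup>2 / 2"
proof -
  have "(norm (x' - y))\<^sup>2 \<le> (norm (x - \<alpha> *\<^sub>R g - y))\<^sup>2"
    using assms by (intro is_projection_norm_le)
  also have "\<dots> = (norm (x - y))\<^sup>2 - 2 * \<alpha> * inner g (x - y) + \<alpha>\<^sup>2 * (norm g)\<^sup>2"
    unfolding power2_norm_eq_inner
    by (simp add: inner_simps inner_commute algebra_simps power2_eq_square)
  also have "\<dots> \<le> (norm (x - y))\<^sup>2 - 2 * \<alpha> * inner g (x - y) + \<alpha>\<^sup>2 * M\<^sup>2"
    using g(2) by (intro add_left_mono mult_left_mono power_mono) auto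
  finally have "inner g (x - y) \<le> ((norm (x - y))\<^sup>2 - (norm (x' - y))\<^sup>2) / (2 * \<alpha>) + \<alpha> * M\<^sup>2 / 2"
    using \<open>\<alpha> > 0\<close> by (simp add: field_simps power2_eq_square)
  moreover have "f x + inner g (y - x) \<le> f y"
    using g(1) \<open>y \<in> S\<close> by (simp add: subdifferential_def)
  ultimately show ?thesis
    by (simp add: inner_diff_right)
qed

text \<open>The three-point inequality controls the loss at the new point \<open>x'\<close>, whereas
  the learner pays at the old point \<open>x\<close>. The Lipschitz bound on the difference is
  absorbed by the proximal term through Young's inequality. The conclusion agrees with that of
  \<open>projected_subgradient_step\<close>, so \<open>online_regret\<close> serves OGA, OGMS and
  OPMS alike.\<close>

lemma proximal_step:
  fixes x y :: "'a::real_inner"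
  assumes conv: "convex_on S f" and lip: "M-lipschitz_on S f"
    and "x \<in> S" and "y \<in> S" and "\<alpha> > 0"
    and min: "is_arg_min (\<lambda>z. f z + (norm (z - x))\<^sup>2 / (2 * \<alpha>)) (\<lambda>z. z \<in> S) x'"
  shows "f x - f y \<le> ((norm (x - y))\<^sup>2 - (norm (x' - y))\<^sup>2) / (2 * \<alpha>) + \<alpha> * M\<^sup>2 / 2"
proof -
  have x': "x' \<in> S"
    using min by (simp add: is_arg_min_def)
  have "f x' + (norm (x' - x))\<^sup>2 / (2 * \<alpha>) + (norm (x' - y))\<^sup>2 / (2 * \<alpha>) \<le>
      f y + (norm (y - x))\<^sup>2 / (2 * \<alpha>)"
    using min by (intro proximal_three_point[OF conv \<open>\<alpha> > 0\<close> x' \<open>y \<in> S\<close>]) (simp add: is_arg_min_linorder)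
  moreover have "f x - f x' \<le> M * norm (x' - x)"
    using lipschitz_on_normD[OF lip \<open>x \<in> S\<close> x'] by (simp add: norm_minus_commute)
  moreover have "M * norm (x' - x) \<le> (norm (x' - x))\<^sup>2 / (2 * \<alpha>) + \<alpha> * M\<^sup>2 / 2"
    using \<open>\<alpha> > 0\<close> by (rule young_ineq)
  ultimately show ?thesis
    by (simp add: diff_divide_distrib norm_minus_commute)
qed

text \<open>The last iterate has no successor, so its loss is controlled by the Lipschitz property and
  Young's inequality instead of a step inequality.\<close>

lemma online_regret:
  fixes u :: "nat \<Rightarrow> 'a::real_normed_vector"
  assumes "\<alpha> > 0" and "T \<ge> 1"
    and step: "\<And>t. 1 \<le> t \<Longrightarrow> t < T \<Longrightarrow>
      f t (u t) - f t y \<le> ((norm (u t - y))\<^sup>2 - (norm (u (Suc t) - y))\<^sup>2) / (2 * \<alpha>) + \<alpha> * M\<^sup>2 / 2"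
    and last: "f T (u T) - f T y \<le> M * norm (u T - y)"
  shows "(\<Sum>t=1..T. f t (u t)) \<le>
    (\<Sum>t=1..T. f t y) + \<alpha> * M\<^sup>2 * real T / 2 + (norm (u 1 - y))\<^sup>2 / (2 * \<alpha>)"
proof -
  have *: "(\<Sum>t=1..m. f t (u t) - f t y) \<le>
      real m * (\<alpha> * M\<^sup>2 / 2) + ((norm (u 1 - y))\<^sup>2 - (norm (u (Suc m) - y))\<^sup>2) / (2 * \<alpha>)"
    if "m < T" for m
    using that
  proof (induction m)
    case (Suc m)
    have "(\<Sum>t=1..m. f t (u t) - f t y) \<le>
        real m * (\<alpha> * M\<^sup>2 / 2) + ((norm (u 1 - y))\<^sup>2 - (norm (u (Suc m) - y))\<^sup>2) / (2 * \<alpha>)"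
      using Suc by simp
    then show ?case
      using step[of "Suc m"] Suc.prems by (simp add: ring_distribs diff_divide_distrib add_divide_distrib)
  qed simp
  obtain m where m: "T = Suc m"
    using \<open>T \<ge> 1\<close> by (cases T) auto
  \<comment> \<open>Young's inequality supplies the last of the \<open>T\<close> copies of the
    constant term, and its quadratic term cancels the negative distance left by the telescoping sum
    at \<open>Suc m = T\<close>.\<close>
  have "f T (u T) - f T y \<le> (norm (u T - y))\<^sup>2 / (2 * \<alpha>) + \<alpha> * M\<^sup>2 / 2"
    using last young_ineq[OF \<open>\<alpha> > 0\<close>, of M "norm (u T - y)"] by linarith
  then have "(\<Sum>t=1..T. f t (u t) - f t y) \<le> real T * (\<alpha> * M\<^sup>2 / 2) + (norm (u 1 - y))\<^sup>2 / (2 * \<alpha>)"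
    using *[of m] by (simp add: m ring_distribs diff_divide_distrib add_divide_distrib)
  then show ?thesis
    by (simp add: sum_subtractf algebra_simps)
qed

section \<open>The meta-loss\<close>

lemma norm_sq_over_ge:
  fixes w q :: "'a::real_inner"
  assumes "r > 0"
  shows "2 * inner w q - r * (norm q)\<^sup>2 \<le> (norm w)\<^sup>2 / r"
proof -
  have "0 \<le> (norm (w - r *\<^sub>R q))\<^sup>2 / r"
    using assms by simp
  also have "\<dots> = (norm w)\<^sup>2 / r - 2 * inner w q + r * (norm q)\<^sup>2"
    unfolding power2_norm_eq_inner using assms
    by (simp add: inner_simps inner_commute field_simps power2_eq_square)
  finally show ?thesis by simp
qed

text \<open>The quadratic over a positive scalar is the supremum over \<open>q\<close> of the affine minorants in
  \<open>norm_sq_over_ge\<close>; convexity follows by taking the \<open>q\<close> that is optimal at the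
  convex combination.\<close>

lemma norm_sq_over_convex:
  fixes v w :: "'a::real_inner"
  assumes "r > 0" "s > 0" "a \<ge> 0" "b \<ge> 0" "a + b = 1"
  shows "(norm (a *\<^sub>R v + b *\<^sub>R w))\<^sup>2 / (a * r + b * s) \<le> a * ((norm v)\<^sup>2 / r) + b * ((norm w)\<^sup>2 / s)"
proof -
  define N R where "N = a *\<^sub>R v + b *\<^sub>R w" and "R = a * r + b * s"
  define q where "q = (1 / R) *\<^sub>R N"
  have "R > 0"
    using assms unfolding R_def
    by (metis add_cancel_right_left add_nonneg_pos add_pos_nonneg less_eq_real_def mult_nonneg_nonneg
        mult_pos_pos zero_neq_one)
  have "(norm N)\<^sup>2 / R = 2 * inner N q - R * (norm q)\<^sup>2"
    unfolding power2_norm_eq_inner q_def using \<open>R > 0\<close> by (simp add: field_simps power2_eq_square)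
  also have "\<dots> = a * (2 * inner v q - r * (norm q)\<^sup>2) + b * (2 * inner w q - s * (norm q)\<^sup>2)"
    by (simp add: N_def R_def inner_simps algebra_simps)
  also have "\<dots> \<le> a * ((norm v)\<^sup>2 / r) + b * ((norm w)\<^sup>2 / s)"
    using assms by (intro add_mono mult_left_mono norm_sq_over_ge)
  finally show ?thesis
    by (simp add: N_def R_def)
qed

text \<open>A convex combination of competitors for \<open>x\<close> and \<open>y\<close> is a
  competitor for the combined point. As the infima need not be attained, the resulting inequality is
  kept for all pairs of competitors and the infimum is taken in one of them at a time.\<close>

lemma convex_on_INF:
  fixes h :: "'a::real_vector \<Rightarrow> 'b::real_vector \<Rightarrow> real"
  assumes conv: "convex_on (A \<times> S) (\<lambda>(a, x). h a x)" and "convex S" and "A \<noteq> {}"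
    and bdd: "\<And>x. x \<in> S \<Longrightarrow> bdd_below ((\<lambda>a. h a x) ` A)"
  shows "convex_on S (\<lambda>x. INF a\<in>A. h a x)"
proof (rule convex_onI)
  fix t x y assume t: "0 < (t::real)" "t < 1" and x: "x \<in> S" and y: "y \<in> S"
  define z where "z = (1 - t) *\<^sub>R x + t *\<^sub>R y"
  define I where "I = (\<lambda>x. INF a\<in>A. h a x)"
  have z: "z \<in> S"
    using \<open>convex S\<close> x y t unfolding convex_alt z_def by auto
  have comb: "I z \<le> (1 - t) * h a x + t * h b y" if a: "a \<in> A" and b: "b \<in> A" for a b
  proof -
    have "(1 - t) *\<^sub>R (a, x) + t *\<^sub>R (b, y) \<in> A \<times> S"
      using conv a b x y t unfolding convex_on_def convex_alt by (meson SigmaI less_imp_le)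
    then have "(1 - t) *\<^sub>R a + t *\<^sub>R b \<in> A"
      by auto
    then have "I z \<le> h ((1 - t) *\<^sub>R a + t *\<^sub>R b) z"
      unfolding I_def using bdd[OF z] by (intro cINF_lower)
    also have "\<dots> \<le> (1 - t) * h a x + t * h b y"
      using convex_onD[OF conv, of t "(a, x)" "(b, y)"] t a b x y by (simp add: z_def)
    finally show ?thesis .
  qed
  \<comment> \<open>Solving for \<open>h a x\<close> with \<open>b\<close> fixed exhibits a lower
    bound independent of \<open>a\<close>; the same is then done for \<open>b\<close>.\<close>
  have "(I z - t * h b y) / (1 - t) \<le> I x" if b: "b \<in> A" for b
    unfolding I_def[THEN fun_cong, of x]
    by (rule cINF_greatest[OF \<open>A \<noteq> {}\<close>]) (use comb[OF _ b] t in \<open>simp add: field_simps\<close>)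
  then have "(I z - (1 - t) * I x) / t \<le> h b y" if "b \<in> A" for b
    using that t by (force simp: field_simps)
  then have "(I z - (1 - t) * I x) / t \<le> I y"
    unfolding I_def[THEN fun_cong, of y] by (intro cINF_greatest[OF \<open>A \<noteq> {}\<close>])
  then show "I z \<le> (1 - t) * I x + t * I y"
    using t by (simp add: field_simps)
qed fact

section \<open>Parameter sets and the gradient bound of the meta-objective\<close>

lemma convex_Theta_set: "convex (Theta_set d C)"
proof -
  have "Theta_set d C = Rd d \<inter> cball 0 C"
    by (auto simp: Theta_set_def)
  moreover have "convex (Rd d)"
    by (auto simp: convex_def Rd_def)
  ultimately show ?thesis
    by (simp add: convex_Int)
qed

lemma convex_Lambda_set: "convex (Lambda_set d C n \<beta>)"
  unfolding Lambda_set_def by (intro convex_Times convex_Theta_set) simp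

lemma zero_in_Theta_set: "C \<ge> 0 \<Longrightarrow> 0 \<in> Theta_set d C"
  by (simp add: Theta_set_def Rd_def)

lemma gamma_min_pos: "n \<ge> 1 \<Longrightarrow> gamma_min n \<beta> > 0"
  by (simp add: gamma_min_def)

lemma Theta_set_dist: "x \<in> Theta_set d C \<Longrightarrow> y \<in> Theta_set d C \<Longrightarrow> norm (x - y) \<le> 2 * C"
  using norm_triangle_ineq4[of x y] by (simp add: Theta_set_def)

text \<open>The expression under the infimum of \<open>meta_loss\<close>, named because the
  Lipschitz bound for fixed \<theta> and the joint convexity are both established before the infimum
  is taken.\<close>

definition meta_objective ::
  "real \<Rightarrow> nat \<Rightarrow> (nat \<Rightarrow> fsvec \<Rightarrow> real) \<Rightarrow> fsvec \<Rightarrow> fsvec \<times> real \<Rightarrow> real" where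
  "meta_objective \<Gamma> n l \<theta> = (\<lambda>(v, \<gamma>).
     (\<Sum>i=1..n. l i \<theta>) + \<gamma> * \<Gamma>\<^sup>2 * real n / 2 + (norm (\<theta> - v))\<^sup>2 / (2 * \<gamma>))"

lemma meta_loss_eq: "meta_loss d C \<Gamma> n l x = (INF \<theta>\<in>Theta_set d C. meta_objective \<Gamma> n l \<theta> x)"
  by (simp add: meta_loss_def meta_objective_def split: prod.split)

text \<open>In the proof, \<open>p\<close> and \<open>c - e\<close> bound the two components of the gradient of the
  meta-objective; since \<open>c\<close> and \<open>e\<close> are nonnegative, \<open>(c - e)\<^sup>2\<close> is at most the sum of
  their squares, which are terms of \<open>L\<^sup>2\<close>.\<close>

lemma meta_objective_diff_le:
  assumes \<theta>: "\<theta> \<in> Theta_set d C" and "n \<ge> 1"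
    and x: "x \<in> Lambda_set d C n \<beta>" and y: "y \<in> Lambda_set d C n \<beta>"
  shows "meta_objective \<Gamma> n l \<theta> x - meta_objective \<Gamma> n l \<theta> y \<le> meta_L C \<Gamma> \<beta> n * norm (x - y)"
proof -
  obtain v \<gamma> w \<delta> where xy: "x = (v, \<gamma>)" "y = (w, \<delta>)"
    by (cases x, cases y) auto
  define m where "m = gamma_min n \<beta>"
  have m: "m > 0" "m \<le> \<gamma>" "m \<le> \<delta>"
    using x y gamma_min_pos[OF \<open>n \<ge> 1\<close>] by (auto simp: xy Lambda_set_def m_def)
  define a b where "a = norm (\<theta> - v)" and "b = norm (\<theta> - w)"
  have ab: "0 \<le> a" "0 \<le> b" "a \<le> 2 * C" "b \<le> 2 * C"
    using Theta_set_dist[OF \<theta>] x y by (auto simp: a_def b_def xy Lambda_set_def)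
  define r s where "r = norm (v - w)" and "s = \<gamma> - \<delta>"
  define p c e where "p = 2 * C / m" and "c = real n * \<Gamma>\<^sup>2 / 2" and "e = b\<^sup>2 / (2 * \<gamma> * \<delta>)"
  have "C \<ge> 0" using ab by linarith
  have "a - b \<le> r"
    using norm_triangle_ineq2[of "\<theta> - v" "\<theta> - w"] by (simp add: a_def b_def r_def norm_minus_commute)
  then have "(a + b) * (a - b) \<le> 4 * C * r"
    using ab by (smt (verit) mult_left_mono mult_right_mono norm_ge_zero r_def)
  then have "(a\<^sup>2 - b\<^sup>2) / (2 * \<gamma>) \<le> 4 * C * r / (2 * \<gamma>)"
    using m by (intro divide_right_mono) (auto simp: power2_eq_square algebra_simps)
  also have "\<dots> \<le> 4 * C * r / (2 * m)"
    using m \<open>C \<ge> 0\<close> by (intro divide_left_mono) (auto simp: r_def)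
  finally have 1: "(a\<^sup>2 - b\<^sup>2) / (2 * \<gamma>) \<le> p * r"
    by (simp add: p_def)
  have "b\<^sup>2 \<le> (2 * C)\<^sup>2" "m * m \<le> \<gamma> * \<delta>"
    using ab m by (intro power_mono mult_mono; linarith)+
  then have "e \<le> (2 * C)\<^sup>2 / (2 * (m * m))"
    unfolding e_def using m by (intro frac_le) auto
  then have e: "0 \<le> e" "e \<le> 2 * C\<^sup>2 / m\<^sup>2"
    using m by (auto simp: e_def power2_eq_square)
  have c: "0 \<le> c" by (simp add: c_def)
  \<comment> \<open>First \<open>v\<close> is moved to \<open>w\<close> at step size \<gamma>, then
    \<gamma> to \<delta> at \<open>w\<close>. Since 1/\<gamma> - 1/\<delta> equals
    \<open>- s / (\<gamma> * \<delta>)\<close>, the second change is exactly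
    \<open>(c - e) * s\<close>, and Cauchy-Schwarz in the plane applies.\<close>
  have "meta_objective \<Gamma> n l \<theta> x - meta_objective \<Gamma> n l \<theta> y =
      (a\<^sup>2 - b\<^sup>2) / (2 * \<gamma>) + (c - e) * s"
    using m by (simp add: meta_objective_def xy a_def[symmetric] b_def[symmetric] s_def c_def e_def field_simps)
  also have "\<dots> \<le> p * r + (c - e) * s"
    using 1 by simp
  also have "\<dots> = inner (p, c - e) (r, s)"
    by simp
  also have "\<dots> \<le> norm (p, c - e) * norm (r, s)"
    by (rule norm_cauchy_schwarz)
  also have "norm (p, c - e) \<le> meta_L C \<Gamma> \<beta> n"
  proof -
    have "(c - e)\<^sup>2 \<le> c\<^sup>2 + e\<^sup>2"
      using e c by (simp add: power2_diff)
    also have "e\<^sup>2 \<le> (2 * C\<^sup>2 / m\<^sup>2)\<^sup>2"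
      using e by (intro power_mono)
    finally show ?thesis
      unfolding norm_prod_def meta_L_def m_def[symmetric]
      by (intro real_sqrt_le_mono)
        (simp add: p_def c_def power_divide power_mult_distrib flip: power_mult)
  qed
  also have "norm (r, s) = norm (x - y)"
    by (simp add: xy r_def s_def norm_prod_def)
  finally show ?thesis
    by (simp add: mult_right_mono)
qed

section \<open>Meta-loss of a single task\<close>

locale convex_lipschitz_task =
  fixes d :: nat and C \<Gamma> :: real and n :: nat and l :: "nat \<Rightarrow> fsvec \<Rightarrow> real"
  assumes C_pos: "C > 0" and n_pos: "n \<ge> 1"
    and loss_convex: "\<And>i. i \<in> {1..n} \<Longrightarrow> convex_on (Theta_set d C) (l i)"
    and loss_lipschitz: "\<And>i. i \<in> {1..n} \<Longrightarrow> \<Gamma>-lipschitz_on (Theta_set d C) (l i)"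
begin

lemma Theta_set_nonempty: "Theta_set d C \<noteq> {}"
  using zero_in_Theta_set[of C d] C_pos by auto

text \<open>A lower bound independent of \<theta>: a real infimum lies below its members only if the
  set is bounded below. The Lipschitz property relates every point of the ball to its
  center.\<close>

lemma loss_sum_lower:
  assumes "\<theta> \<in> Theta_set d C"
  shows "(\<Sum>i=1..n. l i 0 - \<Gamma> * C) \<le> (\<Sum>i=1..n. l i \<theta>)"
proof (rule sum_mono)
  fix i assume i: "i \<in> {1..n}"
  have "\<bar>l i 0 - l i \<theta>\<bar> \<le> \<Gamma> * norm \<theta>"
    using lipschitz_on_normD[OF loss_lipschitz[OF i] zero_in_Theta_set assms] C_pos by simp
  also have "\<dots> \<le> \<Gamma> * C"
    using assms lipschitz_on_nonneg[OF loss_lipschitz[OF i]]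
    by (intro mult_left_mono) (auto simp: Theta_set_def)
  finally show "l i 0 - \<Gamma> * C \<le> l i \<theta>" by simp
qed

lemma meta_objective_bdd_below:
  assumes "x \<in> Lambda_set d C n \<beta>"
  shows "bdd_below ((\<lambda>\<theta>. meta_objective \<Gamma> n l \<theta> x) ` Theta_set d C)"
proof (rule bdd_belowI2)
  fix \<theta> assume "\<theta> \<in> Theta_set d C"
  have "snd x > 0"
    using assms gamma_min_pos[OF n_pos, of \<beta>] by (auto simp: Lambda_set_def)
  then show "(\<Sum>i=1..n. l i 0 - \<Gamma> * C) \<le> meta_objective \<Gamma> n l \<theta> x"
    using loss_sum_lower[OF \<open>\<theta> \<in> Theta_set d C\<close>]
    by (auto simp: meta_objective_def case_prod_beta intro!: add_increasing2)
qed

lemma meta_loss_le: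
  assumes "x \<in> Lambda_set d C n \<beta>" "\<theta> \<in> Theta_set d C"
  shows "meta_loss d C \<Gamma> n l x \<le> meta_objective \<Gamma> n l \<theta> x"
  unfolding meta_loss_eq using assms meta_objective_bdd_below by (intro cINF_lower)

text \<open>All the functions under the infimum share one Lipschitz constant, and an infimum
  inherits it; the one-sided inequality is used twice with \<open>x\<close> and \<open>y\<close>
  exchanged.\<close>

lemma meta_loss_lipschitz:
  "(meta_L C \<Gamma> \<beta> n)-lipschitz_on (Lambda_set d C n \<beta>) (meta_loss d C \<Gamma> n l)"
proof (rule lipschitz_onI)
  have *: "meta_loss d C \<Gamma> n l x - meta_L C \<Gamma> \<beta> n * norm (x - y) \<le> meta_loss d C \<Gamma> n l y"
    if x: "x \<in> Lambda_set d C n \<beta>" and y: "y \<in> Lambda_set d C n \<beta>" for x y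
    unfolding meta_loss_eq[of d C \<Gamma> n l y]
  proof (rule cINF_greatest[OF Theta_set_nonempty])
    fix \<theta> assume \<theta>: "\<theta> \<in> Theta_set d C"
    show "meta_loss d C \<Gamma> n l x - meta_L C \<Gamma> \<beta> n * norm (x - y) \<le> meta_objective \<Gamma> n l \<theta> y"
      using meta_objective_diff_le[OF \<theta> n_pos x y, of \<Gamma> l] meta_loss_le[OF x \<theta>] by linarith
  qed
  show "dist (meta_loss d C \<Gamma> n l x) (meta_loss d C \<Gamma> n l y) \<le> meta_L C \<Gamma> \<beta> n * dist x y"
    if "x \<in> Lambda_set d C n \<beta>" "y \<in> Lambda_set d C n \<beta>" for x y
    using *[OF that] *[OF that(2,1)] by (simp add: dist_norm norm_minus_commute abs_le_iff)
qed (simp add: meta_L_def)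

text \<open>The only summand mixing the variables is the quadratic over linear one, evaluated at the
  linear image \<open>(\<theta> - v, \<gamma>)\<close>, hence jointly convex;
  \<open>convex_on_INF\<close> then eliminates \<theta>.\<close>

lemma meta_loss_convex: "convex_on (Lambda_set d C n \<beta>) (meta_loss d C \<Gamma> n l)"
proof -
  have "convex_on (Theta_set d C \<times> Lambda_set d C n \<beta>) (\<lambda>(\<theta>, x). meta_objective \<Gamma> n l \<theta> x)"
  proof (rule convex_onI)
    fix t :: real and X Y
    assume t: "0 < t" "t < 1" and X: "X \<in> Theta_set d C \<times> Lambda_set d C n \<beta>"
      and Y: "Y \<in> Theta_set d C \<times> Lambda_set d C n \<beta>"
    obtain \<theta> v \<gamma> \<theta>' w \<delta> where XY: "X = (\<theta>, v, \<gamma>)" "Y = (\<theta>', w, \<delta>)"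
      by (cases X, cases Y) auto
    have in_sets: "\<theta> \<in> Theta_set d C" "\<theta>' \<in> Theta_set d C" "\<gamma> > 0" "\<delta> > 0"
      using X Y gamma_min_pos[OF n_pos, of \<beta>] by (auto simp: XY Lambda_set_def)
    define N where "N = ((1 - t) *\<^sub>R \<theta> + t *\<^sub>R \<theta>') - ((1 - t) *\<^sub>R v + t *\<^sub>R w)"
    have losses: "(\<Sum>i=1..n. l i ((1 - t) *\<^sub>R \<theta> + t *\<^sub>R \<theta>')) \<le>
        (1 - t) * (\<Sum>i=1..n. l i \<theta>) + t * (\<Sum>i=1..n. l i \<theta>')"
      unfolding sum_distrib_left sum.distrib[symmetric] using t in_sets
      by (intro sum_mono convex_onD[OF loss_convex]) auto
    have "N = (1 - t) *\<^sub>R (\<theta> - v) + t *\<^sub>R (\<theta>' - w)"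
      by (simp add: N_def algebra_simps)
    then have quad: "(norm N)\<^sup>2 / ((1 - t) * \<gamma> + t * \<delta>) \<le>
        (1 - t) * ((norm (\<theta> - v))\<^sup>2 / \<gamma>) + t * ((norm (\<theta>' - w))\<^sup>2 / \<delta>)"
      using norm_sq_over_convex[of \<gamma> \<delta> "1 - t" t "\<theta> - v" "\<theta>' - w"] t in_sets by simp
    \<comment> \<open>The sums and norms are replaced by real variables so that the remaining
      inequality is plain arithmetic; \<open>half\<close> brings the quotients into the shape
      \<open>Q / 2\<close>.\<close>
    have combine: "S + ((1 - t) * \<gamma> + t * \<delta>) * \<Gamma>\<^sup>2 * real n / 2 + Q / 2 \<le>
        (1 - t) * (s + \<gamma> * \<Gamma>\<^sup>2 * real n / 2 + q / 2) + t * (s' + \<delta> * \<Gamma>\<^sup>2 * real n / 2 + q' / 2)"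
      if "S \<le> (1 - t) * s + t * s'" and "Q \<le> (1 - t) * q + t * q'" for S s s' Q q q' :: real
      using that by (simp add: field_simps)
    have half: "a / (2 * b) = a / b / 2" for a b :: real by simp
    have "(\<Sum>i=1..n. l i ((1 - t) *\<^sub>R \<theta> + t *\<^sub>R \<theta>')) +
        ((1 - t) * \<gamma> + t * \<delta>) * \<Gamma>\<^sup>2 * real n / 2 + (norm N)\<^sup>2 / (2 * ((1 - t) * \<gamma> + t * \<delta>)) \<le>
      (1 - t) * ((\<Sum>i=1..n. l i \<theta>) + \<gamma> * \<Gamma>\<^sup>2 * real n / 2 + (norm (\<theta> - v))\<^sup>2 / (2 * \<gamma>)) +
      t * ((\<Sum>i=1..n. l i \<theta>') + \<delta> * \<Gamma>\<^sup>2 * real n / 2 + (norm (\<theta>' - w))\<^sup>2 / (2 * \<delta>))"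
      using losses quad unfolding half by (rule combine)
    then show "(case (1 - t) *\<^sub>R X + t *\<^sub>R Y of (\<theta>, x) \<Rightarrow> meta_objective \<Gamma> n l \<theta> x) \<le>
      (1 - t) * (case X of (\<theta>, x) \<Rightarrow> meta_objective \<Gamma> n l \<theta> x) +
      t * (case Y of (\<theta>, x) \<Rightarrow> meta_objective \<Gamma> n l \<theta> x)"
      by (simp add: XY meta_objective_def N_def)
  qed (intro convex_Times convex_Theta_set convex_Lambda_set)
  then show ?thesis
    unfolding meta_loss_eq[abs_def]
    by (intro convex_on_INF convex_Lambda_set Theta_set_nonempty meta_objective_bdd_below)
qed

text \<open>For a fixed comparator the bound of \<open>online_regret\<close>, with step
  \<open>snd x\<close> and constant \<Gamma>, is literally the meta-objective; it holds for every
  comparator, hence for the infimum.\<close>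

lemma oga_run_le_meta_loss:
  assumes run: "oga_run d C \<Gamma> n l x \<theta>" and x: "x \<in> Lambda_set d C n \<beta>"
  shows "(\<Sum>i=1..n. l i (\<theta> i)) \<le> meta_loss d C \<Gamma> n l x"
  unfolding meta_loss_eq
proof (rule cINF_greatest[OF Theta_set_nonempty])
  fix \<theta>' assume \<theta>': "\<theta>' \<in> Theta_set d C"
  have pos: "snd x > 0"
    using x gamma_min_pos[OF n_pos, of \<beta>] by (auto simp: Lambda_set_def)
  have step: "\<exists>g \<in> subdifferential (Rd d) (Theta_set d C) (l i) (\<theta> i). norm g \<le> \<Gamma> \<and>
      is_projection (Theta_set d C) (\<theta> i - snd x *\<^sub>R g) (\<theta> (Suc i))" if "1 \<le> i" "i < n" for i
    using run that unfolding oga_run_def by (auto dest!: bspec[of _ _ "Suc i"])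
  have mem: "\<theta> i \<in> Theta_set d C" if "1 \<le> i" "i \<le> n" for i
  proof (cases "i = 1")
    case True
    then show ?thesis using run x by (auto simp: oga_run_def Lambda_set_def)
  next
    case False
    then have "1 \<le> i - 1" "i - 1 < n" "Suc (i - 1) = i" using that by auto
    then show ?thesis using step[of "i - 1"] by (auto dest: is_projection_in)
  qed
  have "(\<Sum>i=1..n. l i (\<theta> i)) \<le>
      (\<Sum>i=1..n. l i \<theta>') + snd x * \<Gamma>\<^sup>2 * real n / 2 + (norm (\<theta> 1 - \<theta>'))\<^sup>2 / (2 * snd x)"
  proof (rule online_regret[OF pos n_pos])
    fix i assume i: "1 \<le> i" "i < n"
    show "l i (\<theta> i) - l i \<theta>' \<le>
        ((norm (\<theta> i - \<theta>'))\<^sup>2 - (norm (\<theta> (Suc i) - \<theta>'))\<^sup>2) / (2 * snd x) + snd x * \<Gamma>\<^sup>2 / 2"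
      using step[OF i] mem[of i] i \<theta>' pos
      by (blast intro: projected_subgradient_step[OF convex_Theta_set] less_imp_le)
  next
    show "l n (\<theta> n) - l n \<theta>' \<le> \<Gamma> * norm (\<theta> n - \<theta>')"
      using lipschitz_on_normD[OF loss_lipschitz[of n] mem[of n] \<theta>'] n_pos by simp
  qed
  also have "\<dots> = meta_objective \<Gamma> n l \<theta>' x"
    using run by (simp add: meta_objective_def case_prod_beta oga_run_def norm_minus_commute)
  finally show "(\<Sum>i=1..n. l i (\<theta> i)) \<le> meta_objective \<Gamma> n l \<theta>' x" .
qed

end

section \<open>Regret of the meta-strategies\<close>

text \<open>Origin of the factor \<open>4 + C^2\<close> in \<alpha>: a ball of diameter
  \<open>2 * C\<close> times an interval of positive numbers up to \<open>C^2\<close>.\<close>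

lemma Lambda_set_dist:
  assumes "C > 0" "n \<ge> 1" "x \<in> Lambda_set d C n \<beta>" "y \<in> Lambda_set d C n \<beta>"
  shows "(norm (x - y))\<^sup>2 \<le> C\<^sup>2 * (4 + C\<^sup>2)"
proof -
  have "norm (fst x - fst y) \<le> 2 * C"
    using assms by (intro Theta_set_dist) (auto simp: Lambda_set_def)
  then have "(norm (fst x - fst y))\<^sup>2 \<le> (2 * C)\<^sup>2"
    by (intro power_mono) auto
  moreover have "\<bar>snd x - snd y\<bar> \<le> C\<^sup>2"
    using assms gamma_min_pos[of n \<beta>] by (auto simp: Lambda_set_def gamma_max_def)
  then have "\<bar>snd x - snd y\<bar>\<^sup>2 \<le> (C\<^sup>2)\<^sup>2"
    by (intro power_mono) auto
  moreover have "(norm (x - y))\<^sup>2 = (norm (fst x - fst y))\<^sup>2 + \<bar>snd x - snd y\<bar>\<^sup>2"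
    by (simp add: norm_prod_def)
  ultimately have "(norm (x - y))\<^sup>2 \<le> (2 * C)\<^sup>2 + (C\<^sup>2)\<^sup>2"
    by linarith
  then show ?thesis
    by (simp add: algebra_simps power2_eq_square)
qed

lemma meta_L_pos:
  assumes "C > 0" "n \<ge> 1"
  shows "meta_L C \<Gamma> \<beta> n > 0"
  unfolding meta_L_def using assms gamma_min_pos[of n \<beta>]
  by (simp add: add_nonneg_pos)

text \<open>The square root of a sum of squares is at most the sum of the nonnegative roots, here of
  orders n, n^\<beta> and n^(2 \<beta>); as \<open>n \<ge> 1\<close>, the largest exponent
  dominates.\<close>

lemma meta_L_le:
  assumes "C > 0" "n \<ge> 1" "\<beta> > 0"
  shows "meta_L C \<Gamma> \<beta> n \<le> (\<Gamma>\<^sup>2 / 2 + 2 * C + 2 * C\<^sup>2) * real n powr max 1 (2 * \<beta>)"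
proof -
  define m where "m = gamma_min n \<beta>"
  define a b c where "a = real n * \<Gamma>\<^sup>2 / 2" and "b = 2 * C / m" and "c = 2 * C\<^sup>2 / m\<^sup>2"
  have "m > 0"
    using gamma_min_pos[OF \<open>n \<ge> 1\<close>] by (simp add: m_def)
  then have nonneg: "0 \<le> a" "0 \<le> b" "0 \<le> c"
    using \<open>C > 0\<close> by (auto simp: a_def b_def c_def)
  have "meta_L C \<Gamma> \<beta> n = sqrt (a\<^sup>2 + b\<^sup>2 + c\<^sup>2)"
    unfolding meta_L_def m_def[symmetric]
    by (simp add: a_def b_def c_def power_divide power_mult_distrib flip: power_mult)
  also have "\<dots> \<le> a + b + c"
    using nonneg by (intro real_le_lsqrt) (auto simp: power2_eq_square algebra_simps)
  also have "a \<le> \<Gamma>\<^sup>2 / 2 * real n powr max 1 (2 * \<beta>)"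
  proof -
    have "real n \<le> real n powr max 1 (2 * \<beta>)"
      using powr_mono[of 1 "max 1 (2 * \<beta>)" "real n"] assms by simp
    then have "\<Gamma>\<^sup>2 / 2 * real n \<le> \<Gamma>\<^sup>2 / 2 * real n powr max 1 (2 * \<beta>)"
      by (intro mult_left_mono) auto
    then show ?thesis
      by (simp add: a_def mult.commute)
  qed
  also have "b = 2 * C * real n powr \<beta>"
    by (simp add: b_def m_def gamma_min_def)
  also have "\<dots> \<le> 2 * C * real n powr max 1 (2 * \<beta>)"
    using assms by (auto intro!: mult_left_mono powr_mono)
  also have "c = 2 * C\<^sup>2 * real n powr (2 * \<beta>)"
    by (simp add: c_def m_def gamma_min_def power_divide powr_powr mult.commute flip: powr_numeral)
  also have "\<dots> \<le> 2 * C\<^sup>2 * real n powr max 1 (2 * \<beta>)"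
    using assms by (auto intro!: mult_left_mono powr_mono)
  finally show ?thesis
    by (simp add: distrib_right)
qed

lemma meta_run_in_set:
  assumes run: "ogms_run V S f L \<alpha> T lam \<or> opms_run S f \<alpha> T lam" and t: "t \<in> {1..T}"
  shows "lam t \<in> S"
proof (cases "t = 1")
  case True
  then show ?thesis using run by (auto simp: ogms_run_def opms_run_def)
next
  case False
  then have "t \<in> {2..T}" using t by auto
  then show ?thesis
    using run by (auto simp: ogms_run_def opms_run_def is_arg_min_def dest!: bspec is_projection_in)
qed

lemma meta_run_regret:
  fixes S :: "'a::real_inner set"
  assumes run: "ogms_run V S f L \<alpha> T lam \<or> opms_run S f \<alpha> T lam"
    and convex: "\<And>t. t \<in> {1..T} \<Longrightarrow> convex_on S (f t)"
    and lipschitz: "\<And>t. t \<in> {1..T} \<Longrightarrow> L-lipschitz_on S (f t)"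
    and "\<alpha> > 0" "T \<ge> 1" and y: "y \<in> S"
  shows "(\<Sum>t=1..T. f t (lam t)) \<le>
    (\<Sum>t=1..T. f t y) + \<alpha> * L\<^sup>2 * real T / 2 + (norm (lam 1 - y))\<^sup>2 / (2 * \<alpha>)"
proof (rule online_regret[OF \<open>\<alpha> > 0\<close> \<open>T \<ge> 1\<close>])
  have mem: "lam t \<in> S" if "t \<in> {1..T}" for t
    using run that by (rule meta_run_in_set)
  show "f T (lam T) - f T y \<le> L * norm (lam T - y)"
    using lipschitz_on_normD[OF lipschitz mem y, of T T] \<open>T \<ge> 1\<close> by simp
  fix t assume t: "1 \<le> t" "t < T"
  then have t': "t \<in> {1..T}" "Suc t \<in> {2..T}" "Suc t - 1 = t" by auto
  have "convex S"
    using convex[OF t'(1)] by (simp add: convex_on_def)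
  from run show "f t (lam t) - f t y \<le>
      ((norm (lam t - y))\<^sup>2 - (norm (lam (Suc t) - y))\<^sup>2) / (2 * \<alpha>) + \<alpha> * L\<^sup>2 / 2"
  proof
    assume "ogms_run V S f L \<alpha> T lam"
    \<comment> \<open>Runs index an update by its target, so the update leaving \<open>t\<close> is
      the instance at \<open>Suc t\<close>.\<close>
    then have "\<exists>g\<in>subdifferential V S (f (Suc t - 1)) (lam (Suc t - 1)).
        norm g \<le> L \<and> is_projection S (lam (Suc t - 1) - \<alpha> *\<^sub>R g) (lam (Suc t))"
      unfolding ogms_run_def using t'(2) by blast
    then obtain g where "g \<in> subdifferential V S (f t) (lam t)" "norm g \<le> L"
        "is_projection S (lam t - \<alpha> *\<^sub>R g) (lam (Suc t))"
      unfolding t'(3) by blast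
    then show ?thesis
      by (rule projected_subgradient_step[OF \<open>convex S\<close> mem[OF t'(1)] y \<open>\<alpha> > 0\<close>])
  next
    assume "opms_run S f \<alpha> T lam"
    then have "is_arg_min (\<lambda>x. f (Suc t - 1) x + (norm (x - lam (Suc t - 1)))\<^sup>2 / (2 * \<alpha>))
        (\<lambda>x. x \<in> S) (lam (Suc t))"
      unfolding opms_run_def using t'(2) by blast
    then show ?thesis
      unfolding t'(3)
      by (rule proximal_step[OF convex[OF t'(1)] lipschitz[OF t'(1)] mem[OF t'(1)] y \<open>\<alpha> > 0\<close>])
  qed
qed

text \<open>When \<open>D\<close> equals its bound \<open>C^2 * q\<close>, this \<alpha> makes the
  two summands equal, which minimizes their sum; each is then half of the right-hand side.\<close>

lemma balanced_regret:
  fixes C L q D T :: real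
  assumes "C > 0" "L > 0" "q > 0" "T > 0" "D \<le> C\<^sup>2 * q"
  defines "\<alpha> \<equiv> C / L * sqrt (q / T)"
  shows "\<alpha> * L\<^sup>2 * T / 2 + D / (2 * \<alpha>) \<le> L * (C * sqrt q) * sqrt T"
proof -
  define a b where "a = sqrt q" and "b = sqrt T"
  have ab: "a > 0" "b > 0" "q = a\<^sup>2" "T = b\<^sup>2"
    using assms by (auto simp: a_def b_def)
  have \<alpha>: "\<alpha> = C * a / (L * b)"
    by (simp add: \<alpha>_def a_def b_def real_sqrt_divide)
  then have "\<alpha> > 0" using assms ab by simp
  have "D / (2 * \<alpha>) \<le> C\<^sup>2 * a\<^sup>2 / (2 * \<alpha>)"
    using assms \<open>\<alpha> > 0\<close> ab by (intro divide_right_mono) auto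
  also have "\<dots> = L * (C * a) * b / 2"
    using ab \<open>C > 0\<close> \<open>L > 0\<close> unfolding \<alpha> by (simp add: field_simps power2_eq_square)
  finally have "D / (2 * \<alpha>) \<le> L * (C * a) * b / 2" .
  moreover have "\<alpha> * L\<^sup>2 * T / 2 = L * (C * a) * b / 2"
    using ab \<open>C > 0\<close> \<open>L > 0\<close> unfolding \<alpha> by (simp add: field_simps power2_eq_square)
  ultimately show ?thesis
    by (simp add: a_def b_def)
qed

section \<open>Choice of the comparison parameter\<close>

text \<open>The unconstrained optimum is of order \<open>s / sqrt n\<close>; it is clamped to \<open>[m, C\<^sup>2]\<close>.\<close>

lemma step_size_tradeoff:
  fixes C \<Gamma> m n s :: real
  assumes "C > 0" "0 < m" "m \<le> C\<^sup>2" "n \<ge> 1" "0 \<le> s" "s \<le> 2 * C"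
  obtains \<gamma> where "m \<le> \<gamma>" "\<gamma> \<le> C\<^sup>2"
    "\<gamma> * \<Gamma>\<^sup>2 * n / 2 + s\<^sup>2 / (2 * \<gamma>) \<le> (\<Gamma>\<^sup>2 / 2 + 1 / 2 + 1 / C) * (n * m + s * sqrt n)"
proof -
  define r where "r = sqrt n"
  have r: "r \<ge> 1" "n = r * r"
    using assms by (auto simp: r_def)
  \<comment> \<open>The linear term is charged to \<open>\<Gamma>^2 / 2\<close> and the quadratic
    one to \<open>1 / 2 + 1 / C\<close>: the 1/2 covers the lower clamp and the unclamped case, the
    1/C the upper clamp.\<close>
  have split: "x + y \<le> (\<Gamma>\<^sup>2 / 2 + 1 / 2 + 1 / C) * (n * m + s * r)"
    if "x \<le> \<Gamma>\<^sup>2 / 2 * (n * m + s * r)" "y \<le> (1 / 2 + 1 / C) * (n * m + s * r)" for x y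
    using that by (simp add: distrib_right)
  have nonneg: "0 \<le> n * m" "0 \<le> s * r"
    using assms r by auto
  have half: "y \<le> (1 / 2 + 1 / C) * (n * m + s * r)" if "y \<le> 1 / 2 * (s * r)" for y
  proof -
    have "1 / 2 * (s * r) \<le> (1 / 2 + 1 / C) * (n * m + s * r)"
      using nonneg \<open>C > 0\<close> by (intro mult_mono) auto
    then show ?thesis using that by linarith
  qed
  consider "s \<le> m * r" | "m * r < s" "s \<le> C\<^sup>2 * r" | "C\<^sup>2 * r < s" by linarith
  then show ?thesis
  proof cases
    case 1
    have "m * \<Gamma>\<^sup>2 * n / 2 \<le> \<Gamma>\<^sup>2 / 2 * (n * m + s * r)"
      using mult_left_mono[of "n * m" "n * m + s * r" "\<Gamma>\<^sup>2 / 2"] nonneg by (simp add: mult_ac)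
    moreover have "s\<^sup>2 / (2 * m) \<le> 1 / 2 * (s * r)"
      using mult_left_mono[OF 1 \<open>0 \<le> s\<close>] \<open>0 < m\<close> by (simp add: field_simps power2_eq_square)
    ultimately show ?thesis
      using that[of m] split half assms by (simp add: r_def)
  next
    case 2
    define \<gamma> where "\<gamma> = s / r"
    have "s > 0" using 2 assms r by (smt (verit) mult_pos_pos)
    have "\<gamma> * \<Gamma>\<^sup>2 * n / 2 \<le> \<Gamma>\<^sup>2 / 2 * (n * m + s * r)"
      using mult_left_mono[of "s * r" "n * m + s * r" "\<Gamma>\<^sup>2 / 2"] nonneg r
      by (simp add: \<gamma>_def mult_ac)
    moreover have "s\<^sup>2 / (2 * \<gamma>) \<le> 1 / 2 * (s * r)"
      using \<open>s > 0\<close> r by (simp add: \<gamma>_def field_simps power2_eq_square)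
    moreover have "m \<le> \<gamma>" "\<gamma> \<le> C\<^sup>2"
      using 2 r by (auto simp: \<gamma>_def field_simps)
    ultimately show ?thesis
      using that[of \<gamma>] split half by (simp add: r_def)
  next
    case 3
    \<comment> \<open>At the upper clamp the linear term is still of order \<open>s * r\<close>,
      while the quadratic one is linearized by \<open>s \<le> 2 * C\<close>, whence the constant
      \<open>1 / C\<close>.\<close>
    have "C\<^sup>2 * r * r \<le> s * r"
      using 3 r by (intro mult_right_mono) auto
    then have "C\<^sup>2 * n \<le> n * m + s * r"
      using nonneg by (simp add: r(2) mult.assoc)
    then have "\<Gamma>\<^sup>2 / 2 * (C\<^sup>2 * n) \<le> \<Gamma>\<^sup>2 / 2 * (n * m + s * r)"
      by (intro mult_left_mono) auto
    then have "C\<^sup>2 * \<Gamma>\<^sup>2 * n / 2 \<le> \<Gamma>\<^sup>2 / 2 * (n * m + s * r)"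
      by (simp add: algebra_simps)
    moreover have "s * s \<le> 2 * C * s"
      using assms by (intro mult_right_mono)
    then have "s\<^sup>2 / (2 * C\<^sup>2) \<le> 1 / C * s"
      using \<open>C > 0\<close> by (simp add: field_simps power2_eq_square)
    moreover have "s \<le> s * r"
      using r \<open>0 \<le> s\<close> mult_left_mono[of 1 r s] by simp
    then have "1 / C * s \<le> (1 / 2 + 1 / C) * (n * m + s * r)"
      using nonneg \<open>C > 0\<close> \<open>0 \<le> s\<close> by (intro mult_mono) auto
    ultimately show ?thesis
      using that[of "C\<^sup>2"] split assms by (simp add: r_def)
  qed
qed

lemma mean_in_Theta_set:
  assumes "\<theta> \<in> {1..T} \<rightarrow> Theta_set d C" "T \<ge> 1"
  shows "(1 / real T) *\<^sub>R (\<Sum>t=1..T. \<theta> t) \<in> Theta_set d C"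
  unfolding scaleR_sum_right
  by (intro convex_sum convex_Theta_set) (use assms in auto)

lemma sigma_sq:
  assumes "T \<ge> 1"
  shows "(\<Sum>t=1..T. (norm (\<theta> t - (1 / real T) *\<^sub>R (\<Sum>s=1..T. \<theta> s)))\<^sup>2) = real T * (sigma T \<theta>)\<^sup>2"
  unfolding sigma_def using assms by (simp add: sum_nonneg)

text \<open>A root mean square of distances within the ball; this provides the hypothesis
  \<open>s \<le> 2 * C\<close> of \<open>step_size_tradeoff\<close>.\<close>

lemma sigma_le:
  assumes "\<theta> \<in> {1..T} \<rightarrow> Theta_set d C" "T \<ge> 1"
  shows "sigma T \<theta> \<le> 2 * C"
proof -
  have "norm (\<theta> 1) \<le> C"
    using assms by (auto simp: Theta_set_def)
  then have "0 \<le> C"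
    by (rule order_trans[OF norm_ge_zero])
  have "(norm (\<theta> t - (1 / real T) *\<^sub>R (\<Sum>s=1..T. \<theta> s)))\<^sup>2 \<le> (2 * C)\<^sup>2" if "t \<in> {1..T}" for t
    using assms that mean_in_Theta_set[OF assms]
    by (intro power_mono Theta_set_dist) auto
  then have "real T * (sigma T \<theta>)\<^sup>2 \<le> (\<Sum>t=1..T. (2 * C)\<^sup>2)"
    unfolding sigma_sq[OF assms(2), symmetric] by (intro sum_mono)
  then have "(sigma T \<theta>)\<^sup>2 \<le> (2 * C)\<^sup>2"
    using assms(2) by simp
  then show ?thesis
    by (rule power2_le_imp_le) (use \<open>0 \<le> C\<close> in simp)
qed

lemma (in convex_lipschitz_task) meta_loss_le_at:
  assumes "v \<in> Theta_set d C" "gamma_min n \<beta> \<le> \<gamma>" "\<gamma> \<le> gamma_max C" "\<theta> \<in> Theta_set d C"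
  shows "meta_loss d C \<Gamma> n l (v, \<gamma>) \<le>
    (\<Sum>i=1..n. l i \<theta>) + \<gamma> * \<Gamma>\<^sup>2 * real n / 2 + (norm (\<theta> - v))\<^sup>2 / (2 * \<gamma>)"
  using meta_loss_le[of "(v, \<gamma>)" \<beta> \<theta>] assms by (simp add: Lambda_set_def meta_objective_def)

text \<open>With the mean as initialization, the squared distances of the comparators add up to T
  times the square of sigma. The T tasks thus reduce to a single step-size trade-off with
  \<open>s = sigma T \<theta>\<close>.\<close>

lemma total_meta_loss_le:
  fixes l :: "nat \<Rightarrow> nat \<Rightarrow> fsvec \<Rightarrow> real"
  assumes task: "\<And>t. t \<in> {1..T} \<Longrightarrow> convex_lipschitz_task d C \<Gamma> n (l t)"
    and "C > 0" "n \<ge> 1" "T \<ge> 1" "gamma_min n \<beta> \<le> gamma_max C"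
    and \<theta>: "\<theta> \<in> {1..T} \<rightarrow> Theta_set d C"
  obtains y where "y \<in> Lambda_set d C n \<beta>"
    "(\<Sum>t=1..T. meta_loss d C \<Gamma> n (l t) y) \<le> (\<Sum>t=1..T. \<Sum>i=1..n. l t i (\<theta> t)) +
      (\<Gamma>\<^sup>2 / 2 + 1 / 2 + 1 / C) * (real n powr (1 - \<beta>) + sigma T \<theta> * sqrt (real n)) * real T"
proof -
  define v s where "v = (1 / real T) *\<^sub>R (\<Sum>t=1..T. \<theta> t)" and "s = sigma T \<theta>"
  have s: "0 \<le> s" "s \<le> 2 * C"
    using sigma_le[OF \<theta> \<open>T \<ge> 1\<close>] by (auto simp: s_def sigma_def sum_nonneg)
  obtain \<gamma> where \<gamma>: "gamma_min n \<beta> \<le> \<gamma>" "\<gamma> \<le> C\<^sup>2" and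
    bound: "\<gamma> * \<Gamma>\<^sup>2 * real n / 2 + s\<^sup>2 / (2 * \<gamma>) \<le>
      (\<Gamma>\<^sup>2 / 2 + 1 / 2 + 1 / C) * (real n * gamma_min n \<beta> + s * sqrt (real n))"
    using step_size_tradeoff[of C "gamma_min n \<beta>" "real n" s \<Gamma>] assms s gamma_min_pos[of n \<beta>]
    by (auto simp: gamma_max_def)
  have v: "v \<in> Theta_set d C"
    unfolding v_def using \<theta> \<open>T \<ge> 1\<close> by (rule mean_in_Theta_set)
  have "(\<Sum>t=1..T. meta_loss d C \<Gamma> n (l t) (v, \<gamma>)) \<le>
      (\<Sum>t=1..T. (\<Sum>i=1..n. l t i (\<theta> t)) + \<gamma> * \<Gamma>\<^sup>2 * real n / 2 + (norm (\<theta> t - v))\<^sup>2 / (2 * \<gamma>))"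
    using \<gamma> \<theta> v
    by (intro sum_mono convex_lipschitz_task.meta_loss_le_at[OF task]) (auto simp: gamma_max_def)
  also have "\<dots> = (\<Sum>t=1..T. \<Sum>i=1..n. l t i (\<theta> t)) + real T * (\<gamma> * \<Gamma>\<^sup>2 * real n / 2 + s\<^sup>2 / (2 * \<gamma>))"
    using sigma_sq[OF \<open>T \<ge> 1\<close>, of \<theta>]
    by (simp add: sum.distrib v_def s_def distrib_left flip: sum_divide_distrib)
  also have "\<dots> \<le> (\<Sum>t=1..T. \<Sum>i=1..n. l t i (\<theta> t)) +
      real T * ((\<Gamma>\<^sup>2 / 2 + 1 / 2 + 1 / C) * (real n * gamma_min n \<beta> + s * sqrt (real n)))"
    using bound by (intro add_left_mono mult_left_mono) auto
  also have "real n * gamma_min n \<beta> = real n powr (1 - \<beta>)"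
    using \<open>n \<ge> 1\<close> by (simp add: gamma_min_def powr_diff)
  finally show ?thesis
    using that[of "(v, \<gamma>)"] v \<gamma> by (simp add: Lambda_set_def gamma_max_def s_def mult_ac)
qed

section \<open>Assembly of the total regret\<close>

lemma total_loss_le:
  fixes l :: "nat \<Rightarrow> nat \<Rightarrow> fsvec \<Rightarrow> real"
  assumes task: "\<And>t. t \<in> {1..T} \<Longrightarrow> convex_lipschitz_task d C \<Gamma> n (l t)"
    and "C > 0" "\<beta> > 0" "n \<ge> 1" "T \<ge> 1" "gamma_min n \<beta> \<le> gamma_max C"
    and meta: "ogms_run V (Lambda_set d C n \<beta>) (\<lambda>t. meta_loss d C \<Gamma> n (l t))
       (meta_L C \<Gamma> \<beta> n) (meta_alpha C \<Gamma> \<beta> n T) T lam \<or>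
     opms_run (Lambda_set d C n \<beta>) (\<lambda>t. meta_loss d C \<Gamma> n (l t)) (meta_alpha C \<Gamma> \<beta> n T) T lam"
    and oga: "\<And>t. t \<in> {1..T} \<Longrightarrow> oga_run d C \<Gamma> n (l t) (lam t) (\<theta> t)"
    and \<theta>': "\<theta>' \<in> {1..T} \<rightarrow> Theta_set d C"
  shows "(\<Sum>t=1..T. \<Sum>i=1..n. l t i (\<theta> t i)) \<le> (\<Sum>t=1..T. \<Sum>i=1..n. l t i (\<theta>' t)) +
    (\<Gamma>\<^sup>2 / 2 + 2 * C + 2 * C\<^sup>2) * (C * sqrt (4 + C\<^sup>2)) * (real n powr max 1 (2 * \<beta>) * sqrt (real T)) +
    (\<Gamma>\<^sup>2 / 2 + 1 / 2 + 1 / C) * ((real n powr (1 - \<beta>) + sigma T \<theta>' * sqrt (real n)) * real T)"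
proof -
  define L \<alpha> where "L = meta_L C \<Gamma> \<beta> n" and "\<alpha> = meta_alpha C \<Gamma> \<beta> n T"
  let ?F = "\<lambda>t. meta_loss d C \<Gamma> n (l t)"
  have "L > 0"
    using meta_L_pos \<open>C > 0\<close> \<open>n \<ge> 1\<close> by (simp add: L_def)
  then have "\<alpha> > 0"
    using \<open>C > 0\<close> \<open>T \<ge> 1\<close> by (simp add: \<alpha>_def meta_alpha_def L_def add_pos_nonneg)
  have mem: "lam t \<in> Lambda_set d C n \<beta>" if "t \<in> {1..T}" for t
    using meta that by (rule meta_run_in_set)
  \<comment> \<open>The point \<open>y\<close> depends on the comparators \<theta>', which is
    legitimate because the meta-regret bound holds against every fixed point of the parameter
    set.\<close>
  obtain y where y: "y \<in> Lambda_set d C n \<beta>" and comparator: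
    "(\<Sum>t=1..T. ?F t y) \<le> (\<Sum>t=1..T. \<Sum>i=1..n. l t i (\<theta>' t)) +
      (\<Gamma>\<^sup>2 / 2 + 1 / 2 + 1 / C) * (real n powr (1 - \<beta>) + sigma T \<theta>' * sqrt (real n)) * real T"
    using total_meta_loss_le[where l = l] assms by blast
  have "(\<Sum>t=1..T. \<Sum>i=1..n. l t i (\<theta> t i)) \<le> (\<Sum>t=1..T. ?F t (lam t))"
    by (intro sum_mono convex_lipschitz_task.oga_run_le_meta_loss[OF task oga mem])
  also have "\<dots> \<le> (\<Sum>t=1..T. ?F t y) + \<alpha> * L\<^sup>2 * real T / 2 + (norm (lam 1 - y))\<^sup>2 / (2 * \<alpha>)"
  proof (rule meta_run_regret[OF meta[folded L_def \<alpha>_def] _ _ \<open>\<alpha> > 0\<close> \<open>T \<ge> 1\<close> y])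
    fix t assume t: "t \<in> {1..T}"
    show "convex_on (Lambda_set d C n \<beta>) (?F t)"
      using task[OF t] by (rule convex_lipschitz_task.meta_loss_convex)
    show "L-lipschitz_on (Lambda_set d C n \<beta>) (?F t)"
      unfolding L_def using task[OF t] by (rule convex_lipschitz_task.meta_loss_lipschitz)
  qed
  also have "\<dots> \<le> (\<Sum>t=1..T. ?F t y) + L * (C * sqrt (4 + C\<^sup>2)) * sqrt (real T)"
    using balanced_regret[of C L "4 + C\<^sup>2" "real T" "(norm (lam 1 - y))\<^sup>2"]
      Lambda_set_dist[OF \<open>C > 0\<close> \<open>n \<ge> 1\<close> mem[of 1] y] \<open>C > 0\<close> \<open>L > 0\<close> \<open>T \<ge> 1\<close>
    by (simp add: \<alpha>_def meta_alpha_def L_def add_pos_nonneg)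
  also have "L * (C * sqrt (4 + C\<^sup>2)) * sqrt (real T) \<le>
      (\<Gamma>\<^sup>2 / 2 + 2 * C + 2 * C\<^sup>2) * real n powr max 1 (2 * \<beta>) * (C * sqrt (4 + C\<^sup>2)) * sqrt (real T)"
    using meta_L_le[OF \<open>C > 0\<close> \<open>n \<ge> 1\<close> \<open>\<beta> > 0\<close>] \<open>C > 0\<close>
    by (intro mult_right_mono) (auto simp: L_def)
  finally show ?thesis
    using comparator by (simp add: mult_ac)
qed

theorem theorem4p2:
  fixes C \<Gamma> \<beta> :: real
  assumes "C > 0" and "\<Gamma> > 0" and "\<beta> > 0"
  shows "\<exists>K>0. \<forall>(d::nat) (n::nat) (T::nat) (l :: nat \<Rightarrow> nat \<Rightarrow> fsvec \<Rightarrow> real)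
      (lam :: nat \<Rightarrow> fsvec \<times> real) (\<theta> :: nat \<Rightarrow> nat \<Rightarrow> fsvec).
    d \<ge> 1 \<longrightarrow> n \<ge> 1 \<longrightarrow> T \<ge> 1 \<longrightarrow>
    (\<forall>t\<in>{1..T}. \<forall>i\<in>{1..n}.
       convex_on (Theta_set d C) (l t i) \<and> \<Gamma>-lipschitz_on (Theta_set d C) (l t i)) \<longrightarrow>
    gamma_min n \<beta> < gamma_max C \<longrightarrow>
    (ogms_run (Rd d \<times> UNIV) (Lambda_set d C n \<beta>) (\<lambda>t. meta_loss d C \<Gamma> n (l t))
       (meta_L C \<Gamma> \<beta> n) (meta_alpha C \<Gamma> \<beta> n T) T lam \<or>
     opms_run (Lambda_set d C n \<beta>) (\<lambda>t. meta_loss d C \<Gamma> n (l t))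
       (meta_alpha C \<Gamma> \<beta> n T) T lam) \<longrightarrow>
    (\<forall>t\<in>{1..T}. oga_run d C \<Gamma> n (l t) (lam t) (\<theta> t)) \<longrightarrow>
    (\<Sum>t=1..T. \<Sum>i=1..n. l t i (\<theta> t i)) \<le>
      (INF \<theta>'\<in>{1..T} \<rightarrow> Theta_set d C.
         (\<Sum>t=1..T. \<Sum>i=1..n. l t i (\<theta>' t)) +
         K * (real n powr max 1 (2 * \<beta>) * sqrt (real T) +
              (real n powr (1 - \<beta>) + sigma T \<theta>' * sqrt (real n)) * real T))"
proof -
  \<comment> \<open>\<open>K1\<close> stems from the regret of the meta-strategy and
    \<open>K2\<close> from the step-size trade-off. Their sum serves as the one constant because the
    quantities they multiply are nonnegative.\<close>
  define K1 K2 where "K1 = (\<Gamma>\<^sup>2 / 2 + 2 * C + 2 * C\<^sup>2) * (C * sqrt (4 + C\<^sup>2))"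
    and "K2 = \<Gamma>\<^sup>2 / 2 + 1 / 2 + 1 / C"
  have K: "K1 > 0" "K2 > 0"
    using assms by (auto simp: K1_def K2_def intro!: mult_pos_pos add_nonneg_pos add_pos_nonneg)
  show ?thesis
  proof (intro exI[of _ "K1 + K2"] conjI allI impI)
    show "K1 + K2 > 0" using K by simp
  next
    fix d n T :: nat and l :: "nat \<Rightarrow> nat \<Rightarrow> fsvec \<Rightarrow> real" and lam \<theta>
    assume n: "n \<ge> 1" and T: "T \<ge> 1"
      and loss: "\<forall>t\<in>{1..T}. \<forall>i\<in>{1..n}.
        convex_on (Theta_set d C) (l t i) \<and> \<Gamma>-lipschitz_on (Theta_set d C) (l t i)"
      and gam: "gamma_min n \<beta> < gamma_max C"
      and meta: "ogms_run (Rd d \<times> UNIV) (Lambda_set d C n \<beta>) (\<lambda>t. meta_loss d C \<Gamma> n (l t))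
          (meta_L C \<Gamma> \<beta> n) (meta_alpha C \<Gamma> \<beta> n T) T lam \<or>
        opms_run (Lambda_set d C n \<beta>) (\<lambda>t. meta_loss d C \<Gamma> n (l t)) (meta_alpha C \<Gamma> \<beta> n T) T lam"
      and oga: "\<forall>t\<in>{1..T}. oga_run d C \<Gamma> n (l t) (lam t) (\<theta> t)"
    have task: "convex_lipschitz_task d C \<Gamma> n (l t)" if "t \<in> {1..T}" for t
      using that loss n \<open>C > 0\<close> by unfold_locales auto
    have "{1..T} \<rightarrow> Theta_set d C \<noteq> {}"
      using zero_in_Theta_set[of C d] \<open>C > 0\<close> by (auto intro!: exI[of _ "\<lambda>_. 0"])
    then show "(\<Sum>t=1..T. \<Sum>i=1..n. l t i (\<theta> t i)) \<le>
      (INF \<theta>'\<in>{1..T} \<rightarrow> Theta_set d C.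
         (\<Sum>t=1..T. \<Sum>i=1..n. l t i (\<theta>' t)) +
         (K1 + K2) * (real n powr max 1 (2 * \<beta>) * sqrt (real T) +
              (real n powr (1 - \<beta>) + sigma T \<theta>' * sqrt (real n)) * real T))"
    proof (rule cINF_greatest)
      fix \<theta>' assume \<theta>': "\<theta>' \<in> {1..T} \<rightarrow> Theta_set d C"
      define A B where "A = real n powr max 1 (2 * \<beta>) * sqrt (real T)"
        and "B = (real n powr (1 - \<beta>) + sigma T \<theta>' * sqrt (real n)) * real T"
      have "0 \<le> A" "0 \<le> B"
        by (auto simp: A_def B_def sigma_def sum_nonneg)
      then have "K1 * A + K2 * B \<le> (K1 + K2) * (A + B)"
        using K by (simp add: distrib_left distrib_right)
      moreover have "(\<Sum>t=1..T. \<Sum>i=1..n. l t i (\<theta> t i)) \<le>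
          (\<Sum>t=1..T. \<Sum>i=1..n. l t i (\<theta>' t)) + K1 * A + K2 * B"
        unfolding K1_def K2_def A_def B_def
        using task assms n T gam oga \<theta>' by (intro total_loss_le[OF _ _ _ _ _ _ meta]) auto
      ultimately show "(\<Sum>t=1..T. \<Sum>i=1..n. l t i (\<theta> t i)) \<le>
          (\<Sum>t=1..T. \<Sum>i=1..n. l t i (\<theta>' t)) + (K1 + K2) * (A + B)"
        by linarith
    qed
  qed
qed

end
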